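(* Let $N\ge 2$, let $\Omega\subset\mathbb{R}^N$ be a bounded open set with Lipschitz boundary, and let $s_1,s_2\in(0,1)$ and $p,q\in(1,\infty)$. Let $\lambda\in\mathbb{R}$ and let $u\in X_{s_1,p}\cap X_{s_2,q}$ be a (weak) solution of the problem $$(-\Delta)_p^{s_1}u+(-\Delta)_q^{s_2}u=\lambda|u|^{q-2}u\ \text{ in }\Omega,\qquad \mathcal{N}_{p,s_1}u+\mathcal{N}_{q,s_2}u=0\ \text{ on }\mathbb{R}^N\setminus\overline{\Omega}.$$ Then $u\in L^\infty(\mathbb{R}^N)$ and $$\|u\|_{L^\infty(\mathbb{R}^N)}\le 2\|u\|_{L^\infty(\Omega)}.$$
   Context: Notation: $\Omega^c=\mathbb{R}^N\setminus\Omega$ and $\mathcal{Q}=(\mathbb{R}^N\times\mathbb{R}^N)\setminus(\Omega^c\times\Omega^c)$. For $s\in(0,1)$ and $r\in(1,\infty)$, $[u]_{s,r}=\Big(\iint_{\mathcal{Q}}\frac{|u(x)-u(y)|^r}{|x-y|^{N+sr}}\,dx\,dy\Big)^{1/r}$, $\|u\|_{s,r}=\big(\|u\|_{L^r(\Omega)}^r+[u]_{s,r}^r\big)^{1/r}$, and $X_{s,r}$ is the space of measurable $u:\mathbb{R}^N\to\mathbb{R}$ with $\|u\|_{s,r}<\infty$. Up to normalization constants, $(-\Delta)_r^su(x)=\lim_{\varepsilon\to0^+}\int_{\mathbb{R}^N\setminus B_\varepsilon(x)}\frac{|u(x)-u(y)|^{r-2}(u(x)-u(y))}{|x-y|^{N+rs}}\,dy$,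 and $\mathcal{N}_{r,s}u(x)=\int_\Omega\frac{|u(x)-u(y)|^{r-2}(u(x)-u(y))}{|x-y|^{N+rs}}\,dy$ for $x\in\mathbb{R}^N\setminus\overline\Omega$. A function $u\in X_{s_1,p}\cap X_{s_2,q}$ is a (weak) solution of the problem if for all $v\in X_{s_1,p}\cap X_{s_2,q}$ $$\iint_{\mathcal{Q}}\frac{|u(x)-u(y)|^{p-2}(u(x)-u(y))(v(x)-v(y))}{|x-y|^{N+ps_1}}\,dx\,dy+\iint_{\mathcal{Q}}\frac{|u(x)-u(y)|^{q-2}(u(x)-u(y))(v(x)-v(y))}{|x-y|^{N+qs_2}}\,dx\,dy=\lambda\int_\Omega|u|^{q-2}uv\,dx.$$ *)

theory Defs
  imports "HOL-Analysis.Analysis" "HOL-Probability.Essential_Supremum"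
begin

text \<open>
  The space \<open>\<real>\<^sup>N\<close> is a Euclidean space \<open>'a\<close> with \<open>N = DIM('a)\<close>. "Measurable" means Lebesgue
  measurable, and double integrals are taken over the product of two copies of Lebesgue measure.
\<close>

text \<open>
  Near each boundary point and after a rigid motion, \<open>\<Omega>\<close> is the region strictly above
  the graph of a Lipschitz function. The unit vector \<open>e\<close> plays the role of the last coordinate
  direction, and the hyperplane orthogonal to \<open>e\<close> that of \<open>\<real>\<^sup>N\<^sup>-\<^sup>1\<close>.
\<close>
definition lipschitz_boundary :: "'a::euclidean_space set \<Rightarrow> bool" where
  "lipschitz_boundary \<Omega> \<longleftrightarrow>
    (\<forall>x0 \<in> frontier \<Omega>. \<exists>r>0. \<exists>e L. \<exists>\<gamma> :: 'a \<Rightarrow> real.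
        norm e = 1 \<and> L-lipschitz_on {z. e \<bullet> z = 0} \<gamma> \<and>
        \<Omega> \<inter> ball x0 r = {x \<in> ball x0 r. \<gamma> (x - (e \<bullet> x) *\<^sub>R e) < e \<bullet> x})"

definition Q_set :: "'a set \<Rightarrow> ('a \<times> 'a) set" where
  "Q_set \<Omega> = (UNIV \<times> UNIV) - ((- \<Omega>) \<times> (- \<Omega>))"

text \<open>Real powers on \<open>[0, \<infinity>]\<close>, intended for exponents \<open>a > 0\<close>.\<close>
definition enn_powr :: "ennreal \<Rightarrow> real \<Rightarrow> ennreal" where
  "enn_powr t a = (if t = \<infinity> then \<infinity> else ennreal (enn2real t powr a))"

text \<open>
  On the diagonal \<open>x = y\<close>, a null set of the product measure, the integrands below take the value
  0 by the convention for division by zero.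
\<close>
definition gagliardo_seminorm ::
    "'a::euclidean_space set \<Rightarrow> real \<Rightarrow> real \<Rightarrow> ('a \<Rightarrow> real) \<Rightarrow> ennreal" where
  "gagliardo_seminorm \<Omega> s r u =
    enn_powr
      (\<integral>\<^sup>+(x, y) \<in> Q_set \<Omega>.
         ennreal (\<bar>u x - u y\<bar> powr r / norm (x - y) powr (real DIM('a) + s * r))
       \<partial>(lebesgue \<Otimes>\<^sub>M lebesgue))
      (1 / r)"

definition X_norm ::
    "'a::euclidean_space set \<Rightarrow> real \<Rightarrow> real \<Rightarrow> ('a \<Rightarrow> real) \<Rightarrow> ennreal" where
  "X_norm \<Omega> s r u =
    enn_powr
      ((\<integral>\<^sup>+x\<in>\<Omega>. ennreal (\<bar>u x\<bar> powr r) \<partial>lebesgue) + enn_powr (gagliardo_seminorm \<Omega> s r u) r)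
      (1 / r)"

definition X_space ::
    "'a::euclidean_space set \<Rightarrow> real \<Rightarrow> real \<Rightarrow> ('a \<Rightarrow> real) set" where
  "X_space \<Omega> s r = {u \<in> borel_measurable lebesgue. X_norm \<Omega> s r u < \<infinity>}"

text \<open>
  The Lebesgue integrals occurring in the weak formulation converge absolutely for
  \<open>u\<close>, \<open>v\<close> in \<open>X_space\<close> by Hoelder's inequality, so the convention that a
  non-integrable function has integral 0 is not used.
\<close>
definition gagliardo_form ::
    "'a::euclidean_space set \<Rightarrow> real \<Rightarrow> real \<Rightarrow> ('a \<Rightarrow> real) \<Rightarrow> ('a \<Rightarrow> real) \<Rightarrow> real" where
  "gagliardo_form \<Omega> s r u v =
    set_lebesgue_integral (lebesgue \<Otimes>\<^sub>M lebesgue) (Q_set \<Omega>)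
      (\<lambda>(x, y). \<bar>u x - u y\<bar> powr (r - 2) * (u x - u y) * (v x - v y)
                  / norm (x - y) powr (real DIM('a) + r * s))"

definition weak_solution ::
    "'a::euclidean_space set \<Rightarrow> real \<Rightarrow> real \<Rightarrow> real \<Rightarrow> real \<Rightarrow> real \<Rightarrow> ('a \<Rightarrow> real) \<Rightarrow> bool" where
  "weak_solution \<Omega> s1 p s2 q lam u \<longleftrightarrow>
    u \<in> X_space \<Omega> s1 p \<inter> X_space \<Omega> s2 q \<and>
    (\<forall>v \<in> X_space \<Omega> s1 p \<inter> X_space \<Omega> s2 q.
       gagliardo_form \<Omega> s1 p u v + gagliardo_form \<Omega> s2 q u v
         = lam * (LINT x:\<Omega>|lebesgue. \<bar>u x\<bar> powr (q - 2) * u x * v x))"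

definition Linf_norm :: "'a::euclidean_space set \<Rightarrow> ('a \<Rightarrow> real) \<Rightarrow> ennreal" where
  "Linf_norm A u = esssup (lebesgue_on A) (\<lambda>x. ennreal \<bar>u x\<bar>)"

definition Linf_space :: "'a::euclidean_space set \<Rightarrow> ('a \<Rightarrow> real) set" where
  "Linf_space A = {u \<in> borel_measurable (lebesgue_on A). Linf_norm A u < \<infinity>}"

end

theory Submission
  imports Defs
begin

text \<open>
  Testing the equation with the truncation \<open>w = (u - k)\<^sup>+\<close>, both forms are nonnegative and the
  \<open>(s\<^sub>2, q)\<close> form bounds the energy of \<open>w\<close>, whatever the relation between \<open>p\<close> and \<open>q\<close>. Instead of
  a Sobolev embedding, a Poincare inequality for functions of small support suffices: with
  \<open>A = {w > 0} \<inter> \<Omega>\<close> and \<open>\<sigma> = s\<^sub>2 q / N\<close>, the energy is at least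
  \<open>c |A|\<^sup>-\<^sup>\<sigma> \<integral>\<^sub>\<Omega> w\<^sup>q\<close>, because by the Lipschitz boundary \<open>w\<close> vanishes on a set of measure at least
  \<open>|A|\<close> in \<open>\<Omega> \<inter> B(x, \<rho>)\<close> with \<open>\<rho>\<^sup>N\<close> comparable to \<open>|A|\<close>. This gives
  \<open>\<integral>\<^sub>\<Omega> (u - k)\<^sup>+ \<le> C k |{u > k} \<inter> \<Omega>|\<^bsup>1+\<epsilon>\<^esup>\<close> and a De Giorgi iteration bounds \<open>u\<close> on \<open>\<Omega>\<close>.
  Testing with \<open>(u - M)\<^sup>+\<close> for \<open>M\<close> the bound on \<open>\<Omega>\<close> makes the right-hand side vanish, so
  \<open>u \<le> M\<close> almost everywhere. The same holds for \<open>- u\<close>.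
\<close>

section \<open>Function spaces, truncations, and the form tested with a truncation\<close>

text \<open>This is the double integral before its root is taken, so that estimates need no detour
  through \<open>enn_powr\<close>.\<close>

definition gagliardo_energy ::
    "'a::euclidean_space set \<Rightarrow> real \<Rightarrow> real \<Rightarrow> ('a \<Rightarrow> real) \<Rightarrow> ennreal" where
  "gagliardo_energy \<Omega> s r u =
    (\<integral>\<^sup>+(x, y) \<in> Q_set \<Omega>.
       ennreal (\<bar>u x - u y\<bar> powr r / norm (x - y) powr (real DIM('a) + s * r))
     \<partial>(lebesgue \<Otimes>\<^sub>M lebesgue))"

text \<open>Tonelli in the Poincare inequality and the passage to almost every section in the
  exterior estimate rest on this. Balls of integer radius exhaust the space.\<close>

lemma sigma_finite_lebesgue: "sigma_finite_measure (lebesgue :: 'a::euclidean_space measure)"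
proof
  let ?A = "range (\<lambda>n::nat. ball (0::'a) (real n))"
  have "\<exists>n::nat. norm x < real n" for x :: 'a
    using reals_Archimedean2 by blast
  then have "\<Union>?A = space lebesgue"
    by (auto simp: dist_norm)
  moreover have "\<forall>a\<in>?A. emeasure lebesgue a \<noteq> \<infinity>"
    by (metis imageE infinity_ennreal_def lmeasurable_ball fmeasurableD2)
  ultimately show "\<exists>A. countable A \<and> A \<subseteq> sets (lebesgue :: 'a measure) \<and> \<Union>A = space lebesgue
      \<and> (\<forall>a\<in>A. emeasure lebesgue a \<noteq> \<infinity>)"
    by (intro exI[of _ ?A]) auto
qed

text \<open>The factors are completed, but only preimages of Borel sets are asked for, and Borel
  sets are Lebesgue sets in each factor. This lets \<open>measurable\<close> handle kernels in
  \<open>x - y\<close>.\<close>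

lemma measurable_lebesgue_fst [measurable]:
    "(fst :: 'a::euclidean_space \<times> 'b::euclidean_space \<Rightarrow> 'a)
      \<in> borel_measurable (lebesgue \<Otimes>\<^sub>M lebesgue)"
  and measurable_lebesgue_snd [measurable]:
    "(snd :: 'a::euclidean_space \<times> 'b::euclidean_space \<Rightarrow> 'b)
      \<in> borel_measurable (lebesgue \<Otimes>\<^sub>M lebesgue)"
proof -
  have id: "(\<lambda>x::'c::euclidean_space. x) \<in> borel_measurable lebesgue"
    by (simp add: measurable_completion)
  show "(fst :: 'a \<times> 'b \<Rightarrow> 'a) \<in> borel_measurable (lebesgue \<Otimes>\<^sub>M lebesgue)"
    using measurable_compose[OF measurable_fst id] .
  show "(snd :: 'a \<times> 'b \<Rightarrow> 'b) \<in> borel_measurable (lebesgue \<Otimes>\<^sub>M lebesgue)"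
    using measurable_compose[OF measurable_snd id] .
qed

lemma sets_Q_set [measurable]:
  fixes \<Omega> :: "'a::euclidean_space set"
  assumes "\<Omega> \<in> sets lebesgue"
  shows "Q_set \<Omega> \<in> sets (lebesgue \<Otimes>\<^sub>M lebesgue)"
proof -
  have "UNIV \<times> UNIV - (- \<Omega>) \<times> (- \<Omega>) \<in> sets (lebesgue \<Otimes>\<^sub>M (lebesgue :: 'a measure))"
    using assms by (intro sets.Diff pair_measureI) (auto simp: Compl_in_sets_lebesgue)
  then show ?thesis unfolding Q_set_def .
qed

lemma enn_powr_less_top_iff: "enn_powr t a < top \<longleftrightarrow> t < top"
  by (auto simp: enn_powr_def less_top)

text \<open>Roots and powers by \<open>enn_powr\<close> preserve finiteness in both directions, so
  membership can be tested on the bare integrals.\<close>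

lemma X_space_iff:
  "u \<in> X_space \<Omega> s r \<longleftrightarrow> u \<in> borel_measurable lebesgue
    \<and> (\<integral>\<^sup>+x\<in>\<Omega>. ennreal (\<bar>u x\<bar> powr r) \<partial>lebesgue) < \<infinity> \<and> gagliardo_energy \<Omega> s r u < \<infinity>"
  unfolding X_space_def X_norm_def gagliardo_seminorm_def gagliardo_energy_def
  by (auto simp: enn_powr_less_top_iff ennreal_add_less_top)

text \<open>The first two conditions make \<open>v\<close> an admissible test function, the last one makes its pairing
  with \<open>u\<close> coercive.\<close>
definition truncation_of :: "('a \<Rightarrow> real) \<Rightarrow> ('a \<Rightarrow> real) \<Rightarrow> bool" where
  "truncation_of v u \<longleftrightarrow> (\<forall>x. \<bar>v x\<bar> \<le> \<bar>u x\<bar>)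
    \<and> (\<forall>x y. \<bar>v x - v y\<bar> \<le> \<bar>u x - u y\<bar> \<and> 0 \<le> (u x - u y) * (v x - v y))"

lemma truncation_of_pos_part:
  assumes "0 \<le> k"
  shows "truncation_of (\<lambda>x. max (u x - k) 0) u"
  unfolding truncation_of_def
proof (intro conjI allI)
  fix x y
  show "\<bar>max (u x - k) 0\<bar> \<le> \<bar>u x\<bar>" using assms by (auto simp: max_def)
  show "\<bar>max (u x - k) 0 - max (u y - k) 0\<bar> \<le> \<bar>u x - u y\<bar>" by (auto simp: max_def)
  show "0 \<le> (u x - u y) * (max (u x - k) 0 - max (u y - k) 0)"
    by (auto simp: max_def zero_le_mult_iff)
qed

lemma energy_integrand_measurable [measurable]:
  fixes u :: "'a::euclidean_space \<Rightarrow> real"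
  assumes [measurable]: "u \<in> borel_measurable lebesgue"
  shows "(\<lambda>(x, y). ennreal (\<bar>u x - u y\<bar> powr r / norm (x - y) powr (real DIM('a) + s * r)))
    \<in> borel_measurable (lebesgue \<Otimes>\<^sub>M lebesgue)"
  by measurable

lemma X_space_truncation:
  assumes "truncation_of v u" "v \<in> borel_measurable lebesgue" "u \<in> X_space \<Omega> s r" "0 < r"
  shows "v \<in> X_space \<Omega> s r"
proof -
  have "(\<integral>\<^sup>+x\<in>\<Omega>. ennreal (\<bar>v x\<bar> powr r) \<partial>lebesgue) \<le> (\<integral>\<^sup>+x\<in>\<Omega>. ennreal (\<bar>u x\<bar> powr r) \<partial>lebesgue)"
    using assms(1,4)
    by (intro nn_integral_mono mult_right_mono ennreal_leI powr_mono2) (auto simp: truncation_of_def)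
  moreover have "gagliardo_energy \<Omega> s r v \<le> gagliardo_energy \<Omega> s r u"
    using assms(1,4) unfolding gagliardo_energy_def
    by (intro nn_integral_mono mult_right_mono)
       (auto simp: truncation_of_def intro!: ennreal_leI divide_right_mono powr_mono2)
  ultimately show ?thesis
    using assms(2,3) by (auto simp: X_space_iff)
qed

text \<open>As \<open>d\<close> and \<open>e\<close> never have opposite signs, the pairing equals
  \<open>\<bar>d\<bar> powr (r - 1) * \<bar>e\<bar>\<close>, and monotonicity compares it with both
  ends. At \<open>d = 0\<close> the factor \<open>d\<close> makes it vanish, also for
  \<open>r < 2\<close>.\<close>

lemma powr_pairing:
  fixes d e r :: real
  assumes "1 < r" "\<bar>e\<bar> \<le> \<bar>d\<bar>" "0 \<le> d * e"
  shows "\<bar>e\<bar> powr r \<le> \<bar>d\<bar> powr (r - 2) * d * e" "\<bar>d\<bar> powr (r - 2) * d * e \<le> \<bar>d\<bar> powr r"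
proof -
  have pw: "t powr r = t powr (r - 1) * t" if "0 \<le> t" for t :: real
  proof (cases "t = 0")
    case False
    with that powr_add[of t "r - 1" 1] show ?thesis by simp
  qed simp
  have "\<bar>d\<bar> powr (r - 2) * d * e = \<bar>d\<bar> powr (r - 2) * (\<bar>d\<bar> * \<bar>e\<bar>)"
    using assms(3) by (simp flip: abs_mult)
  also have "\<dots> = \<bar>d\<bar> powr (r - 1) * \<bar>e\<bar>"
  proof (cases "d = 0")
    case False
    then show ?thesis using powr_add[of "\<bar>d\<bar>" "r - 2" 1] by simp
  qed simp
  finally have eq: "\<bar>d\<bar> powr (r - 2) * d * e = \<bar>d\<bar> powr (r - 1) * \<bar>e\<bar>" .
  have "\<bar>e\<bar> powr (r - 1) * \<bar>e\<bar> \<le> \<bar>d\<bar> powr (r - 1) * \<bar>e\<bar>"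
    using assms by (intro mult_right_mono powr_mono2) auto
  then show "\<bar>e\<bar> powr r \<le> \<bar>d\<bar> powr (r - 2) * d * e" by (simp add: eq pw)
  have "\<bar>d\<bar> powr (r - 1) * \<bar>e\<bar> \<le> \<bar>d\<bar> powr (r - 1) * \<bar>d\<bar>"
    using assms by (intro mult_left_mono) auto
  then show "\<bar>d\<bar> powr (r - 2) * d * e \<le> \<bar>d\<bar> powr r" by (simp add: eq pw)
qed

text \<open>By \<open>powr_pairing\<close> the integrand lies between the energy densities of
  \<open>v\<close> and \<open>u\<close>. The upper one gives integrability, hence equality of the
  Bochner and the nonnegative integral; the lower one gives coercivity.\<close>

lemma gagliardo_form_truncation:
  fixes u v :: "'a::euclidean_space \<Rightarrow> real"
  assumes tr: "truncation_of v u" and v[measurable]: "v \<in> borel_measurable lebesgue"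
    and \<Omega>[measurable]: "\<Omega> \<in> sets lebesgue"
    and u: "u \<in> X_space \<Omega> s r" and r: "1 < r"
  shows "0 \<le> gagliardo_form \<Omega> s r u v"
    "ennreal (gagliardo_form \<Omega> s r u v) = (\<integral>\<^sup>+(x, y) \<in> Q_set \<Omega>.
       ennreal (\<bar>u x - u y\<bar> powr (r - 2) * (u x - u y) * (v x - v y)
         / norm (x - y) powr (real DIM('a) + r * s)) \<partial>(lebesgue \<Otimes>\<^sub>M lebesgue))" (is "?B")
    "gagliardo_energy \<Omega> s r v \<le> ennreal (gagliardo_form \<Omega> s r u v)"
proof -
  let ?f = "\<lambda>(x, y). \<bar>u x - u y\<bar> powr (r - 2) * (u x - u y) * (v x - v y)
         / norm (x - y) powr (real DIM('a) + r * s)"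
  let ?M = "lebesgue \<Otimes>\<^sub>M lebesgue :: ('a \<times> 'a) measure"
  have [measurable]: "u \<in> borel_measurable lebesgue" using u by (simp add: X_space_iff)
  have low: "\<bar>v x - v y\<bar> powr r \<le> \<bar>u x - u y\<bar> powr (r - 2) * (u x - u y) * (v x - v y)"
    and up: "\<bar>u x - u y\<bar> powr (r - 2) * (u x - u y) * (v x - v y) \<le> \<bar>u x - u y\<bar> powr r" for x y
    using tr r by (auto intro!: powr_pairing simp: truncation_of_def)
  have nn: "0 \<le> \<bar>u x - u y\<bar> powr (r - 2) * (u x - u y) * (v x - v y)" for x y
    using low[of x y] powr_ge_zero order_trans by blast
  then have nn_f: "0 \<le> ?f z" for z by (auto split: prod.split)
  have "(\<integral>\<^sup>+z. ennreal (norm (indicator (Q_set \<Omega>) z *\<^sub>R ?f z)) \<partial>?M)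
      \<le> gagliardo_energy \<Omega> s r u"
    unfolding gagliardo_energy_def
    by (intro nn_integral_mono)
       (auto split: split_indicator simp: nn up mult.commute[of r] abs_mult
         intro!: ennreal_leI divide_right_mono simp flip: abs_mult)
  also have "\<dots> < \<infinity>" using u by (simp add: X_space_iff)
  finally have int: "integrable ?M (\<lambda>z. indicator (Q_set \<Omega>) z *\<^sub>R ?f z)"
    by (intro integrableI_bounded) auto
  show "0 \<le> gagliardo_form \<Omega> s r u v"
    unfolding gagliardo_form_def set_lebesgue_integral_def
    by (intro integral_nonneg_AE AE_I2) (use nn_f in auto)
  show B: ?B
    unfolding gagliardo_form_def set_lebesgue_integral_def
    by (subst nn_integral_eq_integral[OF int, symmetric])
       (use nn_f in \<open>auto intro!: nn_integral_cong split: split_indicator\<close>)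
  show "gagliardo_energy \<Omega> s r v \<le> ennreal (gagliardo_form \<Omega> s r u v)"
    unfolding B gagliardo_energy_def
    by (intro nn_integral_mono)
       (auto split: split_indicator simp: low mult.commute[of r] intro!: ennreal_leI divide_right_mono)
qed

subsection \<open>Measure density of Lipschitz domains\<close>

text \<open>Moving from \<open>x\<close> by \<open>\<rho> / 2\<close> in the direction
  \<open>e\<close> gains height above the graph. In a small ball around the new point, this gain
  outweighs both the height lost and the rise of the graph.\<close>

lemma lipschitz_graph_corkscrew:
  fixes e :: "'a::euclidean_space"
  assumes e: "norm e = 1" and \<gamma>: "L-lipschitz_on {z. e \<bullet> z = 0} \<gamma>"
    and \<Omega>: "\<Omega> \<inter> ball x0 r = {x \<in> ball x0 r. \<gamma> (x - (e \<bullet> x) *\<^sub>R e) < e \<bullet> x}"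
    and x: "x \<in> \<Omega>" "x \<in> ball x0 (r / 2)" and \<rho>: "0 < \<rho>" "\<rho> \<le> r / 2"
  shows "ball (x + (\<rho> / 2) *\<^sub>R e) (\<rho> / (2 * (L + 1))) \<subseteq> \<Omega> \<inter> ball x \<rho>"
proof
  let ?\<kappa> = "\<rho> / (2 * (L + 1))"
  have L: "0 \<le> L" using \<gamma> by (rule lipschitz_on_nonneg)
  have ee: "e \<bullet> e = 1" using e by (simp add: dot_square_norm)
  fix z assume z: "z \<in> ball (x + (\<rho> / 2) *\<^sub>R e) ?\<kappa>"
  define h where "h = z - (x + (\<rho> / 2) *\<^sub>R e)"
  have zh: "z = x + (\<rho> / 2) *\<^sub>R e + h" by (simp add: h_def)
  have h: "norm h < ?\<kappa>" using z by (simp add: h_def dist_norm norm_minus_commute)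
  have \<kappa>: "?\<kappa> \<le> \<rho> / 2" using L \<rho> by (intro divide_left_mono) auto
  have "norm (z - x) \<le> norm ((\<rho> / 2) *\<^sub>R e) + norm h"
    unfolding zh by (metis add.assoc add_diff_cancel_left' norm_triangle_ineq)
  also have "norm ((\<rho> / 2) *\<^sub>R e) = \<rho> / 2" using e \<rho> by simp
  also have "\<rho> / 2 + norm h < \<rho>" using h \<kappa> by linarith
  finally have zx: "z \<in> ball x \<rho>" by (simp add: dist_norm norm_minus_commute)
  have "dist x0 z \<le> dist x0 x + dist x z" by (rule dist_triangle)
  then have z0: "z \<in> ball x0 r" using x(2) zx \<rho>(2) by simp
  \<comment> \<open>\<open>P\<close> is the orthogonal projection onto the hyperplane on which
    \<open>\<gamma>\<close> is Lipschitz; it does not increase norms.\<close>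
  define P where "P y = y - (e \<bullet> y) *\<^sub>R e" for y
  have P0: "P y \<in> {z. e \<bullet> z = 0}" for y by (simp add: P_def inner_diff_right ee)
  have "P z - P x = P h" by (simp add: P_def zh algebra_simps inner_add_right ee)
  moreover have "norm (P h) \<le> norm h"
  proof -
    have "(norm (P h))\<^sup>2 = (norm h)\<^sup>2 - (e \<bullet> h)\<^sup>2"
      unfolding P_def power2_norm_eq_inner
      by (simp add: inner_diff_left inner_diff_right ee inner_commute power2_eq_square)
    also have "\<dots> \<le> (norm h)\<^sup>2" by simp
    finally show ?thesis by (rule power2_le_imp_le) simp
  qed
  ultimately have "norm (P z - P x) \<le> norm h" by simp
  then have "L * norm (P z - P x) \<le> L * norm h" using L by (rule mult_left_mono)
  then have "\<bar>\<gamma> (P z) - \<gamma> (P x)\<bar> \<le> L * norm h"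
    using lipschitz_onD[OF \<gamma> P0 P0, of z x] by (simp add: dist_norm)
  moreover have "\<bar>e \<bullet> h\<bar> \<le> norm h" using Cauchy_Schwarz_ineq2[of e h] e by simp
  moreover have "e \<bullet> z = e \<bullet> x + \<rho> / 2 + e \<bullet> h" by (simp add: zh inner_add_right ee)
  moreover have "\<gamma> (P x) < e \<bullet> x"
  proof -
    have "x \<in> ball x0 r" using x(2) \<rho> by auto
    then show ?thesis using x(1) \<Omega> unfolding P_def by blast
  qed
  \<comment> \<open>The radius is chosen so that \<open>L + 1\<close> times it is the height gain
    \<open>\<rho> / 2\<close>: here \<open>L * norm h\<close> bounds the rise of the graph and
    \<open>norm h\<close> the height lost.\<close>
  moreover have "L * norm h + norm h \<le> \<rho> / 2"
  proof -
    have "(L + 1) * norm h \<le> (L + 1) * ?\<kappa>" using h L by (intro mult_left_mono) auto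
    also have "\<dots> = \<rho> / 2" using L by (simp add: field_simps)
    finally show ?thesis by (simp add: algebra_simps)
  qed
  ultimately have "\<gamma> (P z) < e \<bullet> z" by linarith
  then show "z \<in> \<Omega> \<inter> ball x \<rho>" using z0 zx \<Omega> unfolding P_def by blast
qed

text \<open>Finitely many charts suffice because the frontier is compact. A ball that misses the
  frontier needs no chart, since it lies in \<open>\<Omega>\<close> entirely.\<close>

lemma lipschitz_boundary_corkscrew:
  fixes \<Omega> :: "'a::euclidean_space set"
  assumes "open \<Omega>" "bounded \<Omega>" "lipschitz_boundary \<Omega>"
  obtains \<kappa> \<rho>\<^sub>0 where "0 < \<kappa>" "0 < \<rho>\<^sub>0"
    "\<And>x \<rho>. x \<in> \<Omega> \<Longrightarrow> 0 < \<rho> \<Longrightarrow> \<rho> \<le> \<rho>\<^sub>0 \<Longrightarrow> \<exists>z. ball z (\<kappa> * \<rho>) \<subseteq> \<Omega> \<inter> ball x \<rho>"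
proof -
  have "\<exists>r \<kappa>. 0 < r \<and> 0 < \<kappa> \<and> (\<forall>x\<in>\<Omega> \<inter> ball x0 (r / 2). \<forall>\<rho>. 0 < \<rho> \<and> \<rho> \<le> r / 2 \<longrightarrow>
      (\<exists>z. ball z (\<kappa> * \<rho>) \<subseteq> \<Omega> \<inter> ball x \<rho>))" if "x0 \<in> frontier \<Omega>" for x0
  proof -
    from that assms(3) obtain r e L \<gamma> where *: "0 < r" "norm e = 1"
      "L-lipschitz_on {z. e \<bullet> z = 0} \<gamma>"
      "\<Omega> \<inter> ball x0 r = {x \<in> ball x0 r. \<gamma> (x - (e \<bullet> x) *\<^sub>R e) < e \<bullet> x}"
      unfolding lipschitz_boundary_def by blast
    have "0 \<le> L" using *(3) by (rule lipschitz_on_nonneg)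
    moreover have "\<exists>z. ball z (1 / (2 * (L + 1)) * \<rho>) \<subseteq> \<Omega> \<inter> ball x \<rho>"
      if "x \<in> \<Omega>" "x \<in> ball x0 (r / 2)" "0 < \<rho>" "\<rho> \<le> r / 2" for x \<rho>
      using lipschitz_graph_corkscrew[OF *(2-4) that] by auto
    ultimately show ?thesis
      using *(1) by (intro exI[of _ r] exI[of _ "1 / (2 * (L + 1))"]) auto
  qed
  then obtain r \<kappa> where r: "\<And>x0. x0 \<in> frontier \<Omega> \<Longrightarrow> 0 < r x0"
    and \<kappa>: "\<And>x0. x0 \<in> frontier \<Omega> \<Longrightarrow> 0 < \<kappa> x0"
    and cork: "\<And>x0 x \<rho>. x0 \<in> frontier \<Omega> \<Longrightarrow> x \<in> \<Omega> \<Longrightarrow> x \<in> ball x0 (r x0 / 2) \<Longrightarrow> 0 < \<rho> \<Longrightarrow>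
      \<rho> \<le> r x0 / 2 \<Longrightarrow> \<exists>z. ball z (\<kappa> x0 * \<rho>) \<subseteq> \<Omega> \<inter> ball x \<rho>"
    by (metis IntI)
  have "compact (frontier \<Omega>)" using assms(2) by (rule compact_frontier_bounded)
  \<comment> \<open>Quarter radii leave room: if \<open>ball x \<rho>\<close> meets
    \<open>ball x0 (r x0 / 4)\<close> and \<open>\<rho> \<le> r x0 / 4\<close>, then
    \<open>x\<close> lies in \<open>ball x0 (r x0 / 2)\<close>, where the chart applies.\<close>
  then obtain F where F: "F \<subseteq> frontier \<Omega>" "finite F" "frontier \<Omega> \<subseteq> (\<Union>x0\<in>F. ball x0 (r x0 / 4))"
    by (rule compactE_image[of _ "frontier \<Omega>" "\<lambda>x0. ball x0 (r x0 / 4)"]) (use r in auto)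
  \<comment> \<open>The inserted 1 covers an empty \<open>F\<close>; for \<open>k\<close> it also
    gives \<open>k \<le> 1\<close>, used for a ball inside \<open>\<Omega>\<close>.\<close>
  define \<rho>\<^sub>0 where "\<rho>\<^sub>0 = Min (insert 1 ((\<lambda>x0. r x0 / 4) ` F))"
  define k where "k = Min (insert 1 (\<kappa> ` F))"
  have "0 < \<rho>\<^sub>0" "0 < k" using F r \<kappa> by (auto simp: \<rho>\<^sub>0_def k_def)
  moreover have "\<exists>z. ball z (k * \<rho>) \<subseteq> \<Omega> \<inter> ball x \<rho>" if x: "x \<in> \<Omega>" and \<rho>: "0 < \<rho>" "\<rho> \<le> \<rho>\<^sub>0" for x \<rho>
  proof (cases "ball x \<rho> \<inter> frontier \<Omega> = {}")
    case True
    \<comment> \<open>A connected set that meets \<open>\<Omega>\<close> and its complement meets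
      the frontier.\<close>
    have "ball x \<rho> \<subseteq> \<Omega>"
    proof (rule ccontr)
      assume "\<not> ball x \<rho> \<subseteq> \<Omega>"
      then have "ball x \<rho> \<inter> frontier \<Omega> \<noteq> {}"
        using x \<rho> by (intro connected_Int_frontier) (auto intro: centre_in_ball[THEN iffD2])
      with True show False by contradiction
    qed
    moreover have "k \<le> 1" using F(2) by (simp add: k_def)
    then have "k * \<rho> \<le> \<rho>" using \<rho> by simp
    then have "ball x (k * \<rho>) \<subseteq> ball x \<rho>" by (rule subset_ball)
    ultimately show ?thesis by blast
  next
    case False
    then obtain y x0 where y: "y \<in> ball x \<rho>" and x0: "x0 \<in> F" "y \<in> ball x0 (r x0 / 4)"
      using F(3) by blast
    have "\<rho>\<^sub>0 \<le> r x0 / 4" "k \<le> \<kappa> x0" unfolding \<rho>\<^sub>0_def k_def using x0(1) F(2)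
      by (rule_tac Min_le; simp)+
    moreover have "dist x0 x \<le> dist x0 y + dist y x" by (rule dist_triangle)
    moreover have "0 < r x0" using F(1) r x0(1) by auto
    ultimately obtain z where "ball z (\<kappa> x0 * \<rho>) \<subseteq> \<Omega> \<inter> ball x \<rho>"
      using cork[of x0 x \<rho>] F(1) x0 x \<rho> y by (auto simp: dist_commute)
    moreover have "k * \<rho> \<le> \<kappa> x0 * \<rho>" using \<open>k \<le> \<kappa> x0\<close> \<rho> by (simp add: mult_right_mono)
    ultimately show ?thesis by (meson subset_ball order_trans)
  qed
  ultimately show thesis using that by blast
qed

text \<open>The corkscrew ball of radius \<open>\<kappa> * \<rho>\<close> already has the required
  volume.\<close>

lemma lipschitz_boundary_measure_density:
  fixes \<Omega> :: "'a::euclidean_space set"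
  assumes "open \<Omega>" "bounded \<Omega>" "lipschitz_boundary \<Omega>"
  obtains c \<rho>\<^sub>0 where "0 < c" "0 < \<rho>\<^sub>0"
    "\<And>x \<rho>. x \<in> \<Omega> \<Longrightarrow> 0 < \<rho> \<Longrightarrow> \<rho> \<le> \<rho>\<^sub>0 \<Longrightarrow> c * \<rho> ^ DIM('a) \<le> measure lebesgue (\<Omega> \<inter> ball x \<rho>)"
proof -
  obtain \<kappa> \<rho>\<^sub>0 where *: "0 < \<kappa>" "0 < \<rho>\<^sub>0"
    "\<And>x \<rho>. x \<in> \<Omega> \<Longrightarrow> 0 < \<rho> \<Longrightarrow> \<rho> \<le> \<rho>\<^sub>0 \<Longrightarrow> \<exists>z. ball z (\<kappa> * \<rho>) \<subseteq> \<Omega> \<inter> ball x \<rho>"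
    using lipschitz_boundary_corkscrew[OF assms] by blast
  let ?c = "unit_ball_vol (real DIM('a)) * \<kappa> ^ DIM('a)"
  have "?c * \<rho> ^ DIM('a) \<le> measure lebesgue (\<Omega> \<inter> ball x \<rho>)" if x: "x \<in> \<Omega>" "0 < \<rho>" "\<rho> \<le> \<rho>\<^sub>0" for x \<rho>
  proof -
    obtain z where z: "ball z (\<kappa> * \<rho>) \<subseteq> \<Omega> \<inter> ball x \<rho>" using *(3)[OF x] by blast
    have "?c * \<rho> ^ DIM('a) = measure lebesgue (ball z (\<kappa> * \<rho>))"
      using *(1) x by (simp add: content_ball power_mult_distrib)
    also have "\<dots> \<le> measure lebesgue (\<Omega> \<inter> ball x \<rho>)"
      using z assms by (intro measure_mono_fmeasurable) (auto intro!: lmeasurable_open bounded_Int)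
    finally show ?thesis .
  qed
  then show thesis using that[of ?c \<rho>\<^sub>0] *(1,2) by simp
qed

subsection \<open>A fractional Poincare inequality\<close>

text \<open>Let \<open>c * \<rho> ^ DIM('a) = 2 * m\<close>. Around a point \<open>x\<close> of
  \<open>\<Omega>\<close> with \<open>0 < w x\<close>, the ball of radius \<open>\<rho>\<close>
  contains at least measure \<open>2 * m\<close> of \<open>\<Omega>\<close>, while \<open>w\<close>
  is positive on measure \<open>m\<close> only. So \<open>w\<close> vanishes on measure at least
  \<open>m\<close> there, and on that part the difference is \<open>w x\<close> and the kernel is
  bounded below by its value at distance \<open>\<rho>\<close>.\<close>

lemma fractional_poincare_small_support:
  fixes w :: "'a::euclidean_space \<Rightarrow> real"
  assumes w[measurable]: "w \<in> borel_measurable lebesgue" and w0: "\<And>x. 0 \<le> w x"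
    and \<Omega>: "\<Omega> \<in> lmeasurable"
    and dens: "\<And>x \<rho>. x \<in> \<Omega> \<Longrightarrow> 0 < \<rho> \<Longrightarrow> \<rho> \<le> \<rho>\<^sub>0 \<Longrightarrow>
      c * \<rho> ^ DIM('a) \<le> measure lebesgue (\<Omega> \<inter> ball x \<rho>)"
    and c: "0 < c" and s: "0 < s" and q: "0 < q"
    and m: "m = measure lebesgue {x \<in> \<Omega>. 0 < w x}" "0 < m"
    and small: "(2 * m / c) powr (1 / real DIM('a)) \<le> \<rho>\<^sub>0"
  shows "ennreal ((c / 2) powr (1 + s * q / DIM('a)) * m powr (- (s * q / DIM('a))))
      * (\<integral>\<^sup>+x\<in>\<Omega>. ennreal (\<bar>w x\<bar> powr q) \<partial>lebesgue) \<le> gagliardo_energy \<Omega> s q w"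
proof -
  have [measurable]: "\<Omega> \<in> sets lebesgue" using \<Omega> by auto
  define N where "N = real DIM('a)"
  have N: "0 < N" by (simp add: N_def)
  define \<sigma> where "\<sigma> = s * q / N"
  define \<rho> where "\<rho> = (2 * m / c) powr (1 / N)"
  define A where "A = {x \<in> \<Omega>. 0 < w x}"
  have A: "A = \<Omega> \<inter> {x \<in> space lebesgue. 0 < w x}" by (auto simp: A_def)
  have A_meas[measurable]: "A \<in> sets lebesgue" unfolding A by measurable
  have A_lm: "A \<in> lmeasurable" using \<Omega> by (rule fmeasurableI2) (auto simp: A_def)
  have \<rho>: "0 < \<rho>" "\<rho> \<le> \<rho>\<^sub>0" using m(2) c small by (auto simp: \<rho>_def N_def)
  have \<rho>N: "\<rho> ^ DIM('a) = 2 * m / c"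
    using m(2) c by (simp add: \<rho>_def N_def powr_powr flip: powr_realpow)
  define K where "K = (c / 2) powr (1 + \<sigma>) * m powr (- \<sigma>)"
  \<comment> \<open>The constant of the statement is the measure \<open>m\<close> of the zero set
    times the kernel at distance \<open>\<rho>\<close>.\<close>
  have K: "K = m / \<rho> powr (N + s * q)"
  proof -
    have "\<rho> powr (N + s * q) = (2 * m / c) powr (1 + \<sigma>)"
      using N by (simp add: \<rho>_def powr_powr \<sigma>_def field_simps)
    also have "\<dots> = m powr (1 + \<sigma>) / (c / 2) powr (1 + \<sigma>)"
      using m(2) c by (simp add: powr_divide powr_mult field_simps)
    finally have *: "\<rho> powr (N + s * q) = m powr (1 + \<sigma>) / (c / 2) powr (1 + \<sigma>)" .
    moreover have "m powr (1 + \<sigma>) = m * m powr \<sigma>" "m powr (- \<sigma>) = 1 / m powr \<sigma>"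
      using m(2) by (simp_all only: powr_add powr_one powr_minus_divide less_imp_le)
    ultimately show ?thesis using m(2) by (simp add: K_def)
  qed
  let ?F = "\<lambda>x y. ennreal (\<bar>w x - w y\<bar> powr q / norm (x - y) powr (N + s * q))
      * indicator (Q_set \<Omega>) (x, y)"
  have inner: "ennreal K * (ennreal (\<bar>w x\<bar> powr q) * indicator \<Omega> x) \<le> (\<integral>\<^sup>+y. ?F x y \<partial>lebesgue)" for x
  proof (cases "x \<in> A")
    case False
    then have "ennreal (\<bar>w x\<bar> powr q) * indicator \<Omega> x = 0"
      using w0[of x] q by (auto simp: A_def split: split_indicator)
    then show ?thesis by (simp only: mult_zero_right zero_le)
  next
    case True
    define S where "S = (\<Omega> \<inter> ball x \<rho>) - A"
    have S[measurable]: "S \<in> sets lebesgue" unfolding S_def by (intro sets.Diff sets.Int) auto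
    have OB: "\<Omega> \<inter> ball x \<rho> \<in> lmeasurable" using \<Omega> by (intro fmeasurable.Int) auto
    have "m \<le> c * \<rho> ^ DIM('a) - m" using \<rho>N c by simp
    also have "\<dots> \<le> measure lebesgue (\<Omega> \<inter> ball x \<rho>) - measure lebesgue A"
      using dens[of x \<rho>] True \<rho> m(1) by (auto simp: A_def)
    also have "\<dots> \<le> measure lebesgue S"
      unfolding S_def using OB A_lm by (rule measure_diff_le_measure_setdiff)
    finally have mS: "ennreal m \<le> emeasure lebesgue S"
      using fmeasurable.Diff[OF OB A_lm] by (subst emeasure_eq_measure2) (auto simp: S_def intro: ennreal_leI)
    let ?k = "\<bar>w x\<bar> powr q / \<rho> powr (N + s * q)"
    have "ennreal K * (ennreal (\<bar>w x\<bar> powr q) * indicator \<Omega> x) \<le> ennreal ?k * ennreal m"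
      using True m(2) K by (auto simp: A_def mult.commute simp flip: ennreal_mult)
    also have "\<dots> \<le> ennreal ?k * emeasure lebesgue S" using mS by (intro mult_left_mono) auto
    also have "\<dots> = (\<integral>\<^sup>+y. ennreal ?k * indicator S y \<partial>lebesgue)"
      by (simp add: nn_integral_cmult_indicator)
    also have "\<dots> \<le> (\<integral>\<^sup>+y. ?F x y \<partial>lebesgue)"
    proof (intro nn_integral_mono)
      fix y
      show "ennreal ?k * indicator S y \<le> ?F x y"
      proof (cases "y \<in> S")
        case y: True
        then have "w y = 0" using w0[of y] by (auto simp: S_def A_def)
        moreover have "x \<noteq> y" using True y by (auto simp: S_def)
        then have "?k \<le> \<bar>w x\<bar> powr q / norm (x - y) powr (N + s * q)"
          using y N s q \<rho>
          by (intro divide_left_mono powr_mono2) (auto simp: S_def dist_norm)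
        moreover have "(x, y) \<in> Q_set \<Omega>" using True by (auto simp: Q_set_def A_def)
        ultimately show ?thesis using y by (simp add: ennreal_leI)
      qed simp
    qed
    finally show ?thesis .
  qed
  \<comment> \<open>Integrating the pointwise bound over \<open>x\<close>, Tonelli turns its
    right-hand side into the energy.\<close>
  interpret sigma_finite_measure "lebesgue :: 'a measure" by (rule sigma_finite_lebesgue)
  have "ennreal K * (\<integral>\<^sup>+x\<in>\<Omega>. ennreal (\<bar>w x\<bar> powr q) \<partial>lebesgue)
      = (\<integral>\<^sup>+x. ennreal K * (ennreal (\<bar>w x\<bar> powr q) * indicator \<Omega> x) \<partial>lebesgue)"
    by (rule nn_integral_cmult[symmetric]) measurable
  also have "\<dots> \<le> (\<integral>\<^sup>+x. \<integral>\<^sup>+y. ?F x y \<partial>lebesgue \<partial>lebesgue)"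
    by (intro nn_integral_mono inner)
  also have "\<dots> = gagliardo_energy \<Omega> s q w"
  proof -
    have "(\<lambda>z. (case z of (x, y) \<Rightarrow> ennreal (\<bar>w x - w y\<bar> powr q / norm (x - y) powr (N + s * q)))
        * indicator (Q_set \<Omega>) z) \<in> borel_measurable (lebesgue \<Otimes>\<^sub>M lebesgue)"
      unfolding N_def
      by (intro borel_measurable_times_ennreal energy_integrand_measurable borel_measurable_indicator
          sets_Q_set w \<open>\<Omega> \<in> sets lebesgue\<close>)
    from nn_integral_fst[OF this] show ?thesis
      unfolding gagliardo_energy_def N_def by (simp only: prod.case)
  qed
  finally show ?thesis unfolding K_def \<sigma>_def N_def .
qed

subsection \<open>De Giorgi iteration\<close>

text \<open>For \<open>k < t\<close> the value \<open>t = v + k\<close> is at most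
  \<open>2 * max v k\<close>, and bounding the power of the maximum by a sum separates
  \<open>v\<close> from \<open>k\<close>.\<close>

lemma caccioppoli_integrand_bound:
  fixes t k q :: real
  assumes "1 < q" "0 \<le> k"
  defines "v \<equiv> max (t - k) 0"
  shows "0 \<le> \<bar>t\<bar> powr (q - 2) * t * v"
    and "\<bar>t\<bar> powr (q - 2) * t * v \<le> 2 powr (q - 1) * (v powr q + k powr (q - 1) * v)"
proof -
  have pw: "x powr (q - 1) * x = x powr q" if "0 \<le> x" for x
  proof (cases "x = 0")
    case False
    with that powr_add[of x "q - 1" 1] show ?thesis by simp
  qed simp
  show "0 \<le> \<bar>t\<bar> powr (q - 2) * t * v"
    using assms by (auto simp: v_def max_def)
  show "\<bar>t\<bar> powr (q - 2) * t * v \<le> 2 powr (q - 1) * (v powr q + k powr (q - 1) * v)"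
  proof (cases "k < t")
    case False
    then show ?thesis by (simp add: v_def)
  next
    case True
    then have t: "0 < t" "t = v + k" "0 < v" using assms by (auto simp: v_def)
    have "\<bar>t\<bar> powr (q - 2) * t = t powr (q - 1)"
      using t(1) powr_add[of t "q - 2" 1] by simp
    also have "\<dots> \<le> (2 * max v k) powr (q - 1)"
      using t assms(1) by (intro powr_mono2) auto
    also have "\<dots> = 2 powr (q - 1) * max v k powr (q - 1)"
      by (rule powr_mult)
    also have "\<dots> \<le> 2 powr (q - 1) * (v powr (q - 1) + k powr (q - 1))"
      by (intro mult_left_mono) (auto simp: max_def)
    finally have "\<bar>t\<bar> powr (q - 2) * t * v \<le> 2 powr (q - 1) * (v powr (q - 1) + k powr (q - 1)) * v"
      using t(3) by (intro mult_right_mono) auto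
    also have "\<dots> = 2 powr (q - 1) * (v powr q + k powr (q - 1) * v)"
      using pw[of v] t(3) by (simp add: algebra_simps)
    finally show ?thesis .
  qed
qed

text \<open>Below \<open>\<tau>\<close> the last term suffices; above it
  \<open>v powr (1 - q) \<le> \<tau> powr (1 - q)\<close>.\<close>

lemma young_weighted:
  fixes v q \<tau> :: real
  assumes "1 < q" "0 \<le> v" "0 < \<tau>"
  shows "v \<le> \<tau> powr (1 - q) * v powr q + \<tau>"
proof (cases "v \<le> \<tau>")
  case True
  have "0 \<le> \<tau> powr (1 - q) * v powr q" by simp
  with True show ?thesis by linarith
next
  case False
  then have v: "\<tau> < v" "0 < v" using assms by auto
  have "v = v powr (1 - q) * v powr q" using v by (simp flip: powr_add)
  also have "\<dots> \<le> \<tau> powr (1 - q) * v powr q"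
    using assms v by (intro mult_right_mono powr_mono2') auto
  finally show ?thesis using assms by simp
qed

text \<open>In the application \<open>m\<close> is the measure of a superlevel set, \<open>I\<close>
  the integral of the excess and \<open>W\<close> that of its \<open>q\<close>-th power. Smallness
  of \<open>m\<close> absorbs \<open>W\<close> on the right of \<open>energy\<close>, which bounds
  \<open>W\<close> by a multiple of \<open>I\<close>; a suitable \<open>\<tau>\<close> in
  \<open>young\<close> then absorbs half of \<open>I\<close>.\<close>

lemma level_estimate_absorption:
  fixes q k m W I \<sigma> K \<Lambda> :: real
  assumes q: "1 < q" and pos: "0 < k" "0 < m" "0 \<le> W" "0 \<le> I" "0 < K" "0 \<le> \<Lambda>"
    and energy: "K * m powr (- \<sigma>) * W \<le> \<Lambda> * (W + k powr (q - 1) * I)"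
    and small: "\<Lambda> * m powr \<sigma> \<le> K / 2"
    and young: "\<And>\<tau>. 0 < \<tau> \<Longrightarrow> I \<le> \<tau> powr (1 - q) * W + \<tau> * m"
  shows "I \<le> 2 * (2 * (2 * \<Lambda> / K + 1)) powr (1 / (q - 1)) * k * m powr (1 + \<sigma> / (q - 1))"
proof -
  define D where "D = 2 * \<Lambda> / K + 1"
  have D: "0 < D" using pos by (auto simp: D_def intro: add_nonneg_pos)
  have "K * W = m powr \<sigma> * (K * m powr (- \<sigma>) * W)"
    using pos by (simp add: powr_minus)
  also have "\<dots> \<le> m powr \<sigma> * (\<Lambda> * (W + k powr (q - 1) * I))"
    using energy by (rule mult_left_mono) simp
  also have "\<dots> = \<Lambda> * m powr \<sigma> * W + \<Lambda> * m powr \<sigma> * k powr (q - 1) * I"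
    by (simp add: algebra_simps)
  also have "\<Lambda> * m powr \<sigma> * W \<le> K / 2 * W"
    using small pos by (intro mult_right_mono) auto
  finally have "K * W \<le> 2 * \<Lambda> * m powr \<sigma> * k powr (q - 1) * I" by simp
  then have "W \<le> 2 * \<Lambda> / K * (m powr \<sigma> * k powr (q - 1) * I)"
    using pos by (simp add: field_simps)
  also have "\<dots> \<le> D * (m powr \<sigma> * k powr (q - 1) * I)"
    using pos by (intro mult_right_mono) (auto simp: D_def)
  finally have W: "W \<le> D * m powr \<sigma> * k powr (q - 1) * I" by (simp add: mult.assoc)
  \<comment> \<open>Here \<open>W\<close> is at most \<open>T / 2 * I\<close> times 1, and
    \<open>\<tau>\<close> solves \<open>\<tau> powr (q - 1) = T\<close>, so the first term of
    \<open>young\<close> is at most \<open>I / 2\<close>.\<close>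
  define T where "T = 2 * D * m powr \<sigma> * k powr (q - 1)"
  define \<tau> where "\<tau> = T powr (1 / (q - 1))"
  have T: "0 < T" using D pos by (simp add: T_def)
  then have \<tau>: "0 < \<tau>" by (simp add: \<tau>_def)
  have "(1 - q) / (q - 1) = - 1" using q by (simp add: field_simps)
  then have "\<tau> powr (1 - q) = T powr (- 1)" unfolding \<tau>_def powr_powr by simp
  then have \<tau>T: "\<tau> powr (1 - q) = 1 / T" using T by (simp add: powr_minus_divide)
  have "I \<le> \<tau> powr (1 - q) * W + \<tau> * m" using young \<tau> by blast
  also have "\<tau> powr (1 - q) * W \<le> \<tau> powr (1 - q) * (T / 2 * I)"
    using W by (intro mult_left_mono) (auto simp: T_def)
  also have "\<dots> = I / 2" using T by (simp add: \<tau>T)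
  finally have "I \<le> 2 * \<tau> * m" by simp
  also have "\<tau> = (2 * D) powr (1 / (q - 1)) * k * m powr (\<sigma> / (q - 1))"
    using q D pos by (simp add: \<tau>_def T_def powr_mult powr_powr)
  finally show ?thesis using pos by (simp add: D_def powr_add mult_ac)
qed

text \<open>The Ladyzhenskaya--Ural'tseva form of the De Giorgi iteration, along the levels
  \<open>k\<^sub>0 (2 - 2\<^sup>-\<^sup>j)\<close>.\<close>
lemma de_giorgi_iteration:
  fixes f :: "real \<Rightarrow> real"
  assumes f0: "\<And>k. 0 \<le> f k" and anti: "antimono f"
    and lim: "(\<lambda>n::nat. f (real n)) \<longlonglongrightarrow> 0"
    and pos: "0 < C" "0 < \<epsilon>" "0 < m\<^sub>0"
    and step: "\<And>k h. 0 < k \<Longrightarrow> k < h \<Longrightarrow> f k \<le> m\<^sub>0 \<Longrightarrow> (h - k) * f h \<le> C * k * f k powr (1 + \<epsilon>)"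
  shows "\<exists>k. f k = 0"
proof -
  \<comment> \<open>The choice \<open>\<theta> powr \<epsilon> = 1 / 2\<close> makes the superlinear
    gain at step \<open>j\<close> cancel the factor \<open>(1 / 2) ^ j\<close> in the gap between
    consecutive levels.\<close>
  define \<theta> where "\<theta> = (1 / 2) powr (1 / \<epsilon>)"
  have \<theta>: "0 < \<theta>" "\<theta> < 1" using pos
    powr_less_mono2[of "1 / \<epsilon>" "1 / 2" 1] by (simp_all add: \<theta>_def)
  have \<theta>\<epsilon>: "\<theta> powr \<epsilon> = 1 / 2" using pos by (simp add: \<theta>_def powr_powr)
  \<comment> \<open>The first entry keeps all levels in the range of \<open>step\<close>; the second
    makes each step gain a factor \<open>\<theta>\<close>.\<close>
  define \<delta> where "\<delta> = min m\<^sub>0 ((\<theta> / (4 * C)) powr (1 / \<epsilon>))"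
  have \<delta>: "0 < \<delta>" "\<delta> \<le> m\<^sub>0" using pos \<theta> by (auto simp: \<delta>_def)
  have "\<delta> powr \<epsilon> \<le> ((\<theta> / (4 * C)) powr (1 / \<epsilon>)) powr \<epsilon>"
    using pos \<delta> by (intro powr_mono2) (auto simp: \<delta>_def)
  also have "\<dots> = \<theta> / (4 * C)" using pos \<theta> by (simp add: powr_powr)
  finally have \<delta>\<epsilon>: "4 * C * \<delta> powr \<epsilon> \<le> \<theta>" using pos by (simp add: field_simps)
  \<comment> \<open>The limit supplies the small start, and \<open>0 < n\<close> makes the starting
    level positive, as \<open>step\<close> requires.\<close>
  have "\<forall>\<^sub>F n::nat in sequentially. f (real n) < \<delta> \<and> 0 < n"
    using order_tendstoD(2)[OF lim \<delta>(1)] eventually_gt_at_top[of 0] by eventually_elim simp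
  then obtain n :: nat where n: "f (real n) < \<delta>" "0 < n"
    by (auto simp: eventually_sequentially)
  define k\<^sub>0 where "k\<^sub>0 = real n"
  have k\<^sub>0: "0 < k\<^sub>0" "f k\<^sub>0 < \<delta>" using n by (auto simp: k\<^sub>0_def)
  define k where "k j = k\<^sub>0 * (2 - (1 / 2) ^ j)" for j :: nat
  have k_bds: "k\<^sub>0 \<le> k j" "k j \<le> 2 * k\<^sub>0" for j
    using k\<^sub>0 power_le_one[of "1 / 2 :: real" j] by (auto simp: k_def)
  have k_pos: "0 < k j" for j using k_bds(1)[of j] k\<^sub>0 by linarith
  have k_diff: "k (Suc j) - k j = k\<^sub>0 / 2 * (1 / 2) ^ j" for j
    by (simp add: k_def algebra_simps)
  have decay: "f (k j) \<le> \<delta> * \<theta> ^ j" for j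
  proof (induction j)
    case 0
    then show ?case using k\<^sub>0 by (simp add: k_def)
  next
    case (Suc j)
    have "\<delta> * \<theta> ^ j \<le> \<delta>" using \<delta> \<theta> by (simp add: power_le_one)
    then have "f (k j) \<le> m\<^sub>0" using Suc \<delta> by linarith
    moreover have "k j < k (Suc j)" 
    proof -
      have "0 < k\<^sub>0 / 2 * (1 / 2) ^ j" using k\<^sub>0 by simp
      then show ?thesis using k_diff[of j] by linarith
    qed
    ultimately have "(k (Suc j) - k j) * f (k (Suc j)) \<le> C * k j * f (k j) powr (1 + \<epsilon>)"
      using step k_pos by blast
    also have "\<dots> \<le> C * (2 * k\<^sub>0) * (\<delta> * \<theta> ^ j) powr (1 + \<epsilon>)"
      using Suc pos k_bds(2)[of j] k_pos[of j] f0
      by (intro mult_mono powr_mono2) auto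
    also have "(\<delta> * \<theta> ^ j) powr (1 + \<epsilon>) = \<delta> powr \<epsilon> * (\<theta> powr \<epsilon>) ^ j * (\<delta> * \<theta> ^ j)"
    proof -
      have "(\<theta> ^ j) powr \<epsilon> = (\<theta> powr \<epsilon>) ^ j"
        using \<theta> by (simp add: powr_powr mult.commute flip: powr_realpow)
      then show ?thesis using \<delta> \<theta> by (simp add: powr_add powr_mult)
    qed
    finally have "k\<^sub>0 / 2 * (1 / 2) ^ j * f (k (Suc j))
        \<le> C * (2 * k\<^sub>0) * (\<delta> powr \<epsilon> * (1 / 2) ^ j * (\<delta> * \<theta> ^ j))"
      by (simp add: k_diff \<theta>\<epsilon>)
    then have "(k\<^sub>0 / 2 * (1 / 2) ^ j) * f (k (Suc j))
        \<le> (k\<^sub>0 / 2 * (1 / 2) ^ j) * (4 * C * \<delta> powr \<epsilon> * (\<delta> * \<theta> ^ j))"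
      by (simp add: algebra_simps)
    then have "f (k (Suc j)) \<le> 4 * C * \<delta> powr \<epsilon> * (\<delta> * \<theta> ^ j)"
      using k\<^sub>0(1) by (simp add: mult_le_cancel_left mult_ac)
    also have "\<dots> \<le> \<theta> * (\<delta> * \<theta> ^ j)"
      using \<delta>\<epsilon> \<delta> \<theta> by (intro mult_right_mono) auto
    finally show ?case by (simp add: mult_ac)
  qed
  \<comment> \<open>All levels stay below \<open>2 * k\<^sub>0\<close>, so monotonicity passes the
    decay on to that level.\<close>
  have "(\<lambda>j. \<delta> * \<theta> ^ j) \<longlonglongrightarrow> \<delta> * 0"
    using \<theta> by (intro tendsto_mult tendsto_const LIMSEQ_power_zero) auto
  moreover have "f (2 * k\<^sub>0) \<le> \<delta> * \<theta> ^ j" for j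
    using decay[of j] antimonoD[OF anti k_bds(2)[of j]] by linarith
  ultimately have "f (2 * k\<^sub>0) \<le> 0" by (intro LIMSEQ_le_const) auto
  with f0 show ?thesis by (metis antisym)
qed

subsection \<open>Boundedness in the domain\<close>

lemma set_integrable_dominated:
  fixes f g :: "'a \<Rightarrow> real"
  assumes "set_integrable M A f" "g \<in> borel_measurable M" "A \<in> sets M"
    and "\<And>x. x \<in> A \<Longrightarrow> \<bar>g x\<bar> \<le> f x"
  shows "set_integrable M A g"
proof (rule set_integrable_bound[OF assms(1)])
  show "set_borel_measurable M A g"
    unfolding set_borel_measurable_def using assms(2,3) by measurable
  show "AE x in M. x \<in> A \<longrightarrow> norm (g x) \<le> norm (f x)"
    using assms(4) by (force intro: AE_I2)
qed

text \<open>The locale carries the one-sided argument, so that it can be instantiated both for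
  \<open>u\<close> and for \<open>- u\<close>.\<close>

locale pq_eigenproblem =
  fixes \<Omega> :: "'a::euclidean_space set" and s1 p s2 q lam :: real and u :: "'a \<Rightarrow> real"
  assumes open_\<Omega>: "open \<Omega>" and bounded_\<Omega>: "bounded \<Omega>" and lipschitz_\<Omega>: "lipschitz_boundary \<Omega>"
    and s2: "0 < s2" and p: "1 < p" and q: "1 < q"
    and weak: "weak_solution \<Omega> s1 p s2 q lam u"
begin

abbreviation excess :: "real \<Rightarrow> 'a \<Rightarrow> real" where
  "excess k x \<equiv> max (u x - k) 0"

abbreviation superlevel :: "real \<Rightarrow> 'a set" where
  "superlevel k \<equiv> {x \<in> \<Omega>. k < u x}"

lemma \<Omega>_lmeasurable: "\<Omega> \<in> lmeasurable"
  using bounded_\<Omega> open_\<Omega> by (rule lmeasurable_open)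

lemma \<Omega>_sets [measurable]: "\<Omega> \<in> sets lebesgue"
  using \<Omega>_lmeasurable by auto

lemma u_measurable [measurable]: "u \<in> borel_measurable lebesgue"
  using weak by (simp add: weak_solution_def X_space_iff)

lemma superlevel_lmeasurable: "superlevel k \<in> lmeasurable"
proof (rule fmeasurableI2[OF \<Omega>_lmeasurable])
  have "superlevel k = \<Omega> \<inter> {x \<in> space lebesgue. k < u x}" by auto
  also have "\<dots> \<in> sets lebesgue" by measurable
  finally show "superlevel k \<in> sets lebesgue" .
qed auto

lemma AE_not_superlevel:
  assumes "measure lebesgue (superlevel k) = 0"
  shows "AE x in lebesgue. x \<notin> superlevel k"
proof (rule AE_not_in, rule null_setsI)
  show "emeasure lebesgue (superlevel k) = 0"
    using emeasure_eq_measure2[OF superlevel_lmeasurable[of k]] assms by simp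
  show "superlevel k \<in> sets lebesgue" using superlevel_lmeasurable by (rule fmeasurableD)
qed

lemma excess_admissible:
  assumes "0 \<le> k"
  shows "excess k \<in> X_space \<Omega> s1 p \<inter> X_space \<Omega> s2 q"
proof -
  have "excess k \<in> borel_measurable lebesgue" by measurable
  then show ?thesis
    using X_space_truncation[OF truncation_of_pos_part[OF assms, of u]] weak p q
    unfolding weak_solution_def by auto
qed

lemma excess_forms:
  assumes "0 \<le> k"
  shows "0 \<le> gagliardo_form \<Omega> s1 p u (excess k)" "0 \<le> gagliardo_form \<Omega> s2 q u (excess k)"
    and "gagliardo_form \<Omega> s1 p u (excess k) + gagliardo_form \<Omega> s2 q u (excess k)
      = lam * (LINT x:\<Omega>|lebesgue. \<bar>u x\<bar> powr (q - 2) * u x * excess k x)"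
    and "gagliardo_energy \<Omega> s2 q (excess k)
      \<le> ennreal (lam * (LINT x:\<Omega>|lebesgue. \<bar>u x\<bar> powr (q - 2) * u x * excess k x))"
proof -
  have tr: "truncation_of (excess k) u" using assms by (rule truncation_of_pos_part)
  have meas: "excess k \<in> borel_measurable lebesgue" by measurable
  have X: "u \<in> X_space \<Omega> s1 p" "u \<in> X_space \<Omega> s2 q" using weak by (auto simp: weak_solution_def)
  show f1: "0 \<le> gagliardo_form \<Omega> s1 p u (excess k)"
    by (rule gagliardo_form_truncation(1)[OF tr meas \<Omega>_sets X(1) p])
  show "0 \<le> gagliardo_form \<Omega> s2 q u (excess k)"
    by (rule gagliardo_form_truncation(1)[OF tr meas \<Omega>_sets X(2) q])
  show eq: "gagliardo_form \<Omega> s1 p u (excess k) + gagliardo_form \<Omega> s2 q u (excess k)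
      = lam * (LINT x:\<Omega>|lebesgue. \<bar>u x\<bar> powr (q - 2) * u x * excess k x)"
    using weak excess_admissible[OF assms] unfolding weak_solution_def by blast
  have "gagliardo_energy \<Omega> s2 q (excess k) \<le> ennreal (gagliardo_form \<Omega> s2 q u (excess k))"
    by (rule gagliardo_form_truncation(3)[OF tr meas \<Omega>_sets X(2) q])
  also have "\<dots> \<le> ennreal (lam * (LINT x:\<Omega>|lebesgue. \<bar>u x\<bar> powr (q - 2) * u x * excess k x))"
    using f1 eq by (intro ennreal_leI) linarith
  finally show "gagliardo_energy \<Omega> s2 q (excess k)
      \<le> ennreal (lam * (LINT x:\<Omega>|lebesgue. \<bar>u x\<bar> powr (q - 2) * u x * excess k x))" .
qed

lemma set_integrable_u_powr: "set_integrable lebesgue \<Omega> (\<lambda>x. \<bar>u x\<bar> powr q)"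
proof -
  have "(\<integral>\<^sup>+x\<in>\<Omega>. ennreal (\<bar>u x\<bar> powr q) \<partial>lebesgue) < \<infinity>"
    using weak by (simp add: weak_solution_def X_space_iff)
  moreover have "(\<integral>\<^sup>+x. ennreal (norm (indicator \<Omega> x *\<^sub>R \<bar>u x\<bar> powr q)) \<partial>lebesgue)
      = (\<integral>\<^sup>+x\<in>\<Omega>. ennreal (\<bar>u x\<bar> powr q) \<partial>lebesgue)"
    by (intro nn_integral_cong) (auto split: split_indicator)
  ultimately show ?thesis
    unfolding set_integrable_def by (intro integrableI_bounded) auto
qed

lemma set_integrable_const_\<Omega>: "set_integrable lebesgue \<Omega> (\<lambda>x. c :: real)"
  unfolding set_integrable_def using \<Omega>_lmeasurable
  by (auto simp: fmeasurable_def)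

lemma set_integrable_excess:
  assumes "0 \<le> k"
  shows "set_integrable lebesgue \<Omega> (\<lambda>x. excess k x powr q)" "set_integrable lebesgue \<Omega> (excess k)"
    "set_integrable lebesgue \<Omega> (\<lambda>x. \<bar>u x\<bar> powr (q - 2) * u x * excess k x)"
proof -
  have le: "excess k x \<le> \<bar>u x\<bar>" for x using assms by auto
  show 1: "set_integrable lebesgue \<Omega> (\<lambda>x. excess k x powr q)"
    using le q by (intro set_integrable_dominated[OF set_integrable_u_powr]) (auto intro!: powr_mono2)
  \<comment> \<open>Young with weight 1 bounds the excess by its \<open>q\<close>-th power plus a
    constant, which is integrable on \<open>\<Omega>\<close>.\<close>
  show 2: "set_integrable lebesgue \<Omega> (excess k)"
  proof (rule set_integrable_dominated)
    show "set_integrable lebesgue \<Omega> (\<lambda>x. excess k x powr q + 1)"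
      using 1 set_integrable_const_\<Omega> by (rule set_integral_add)
    show "\<bar>excess k x\<bar> \<le> excess k x powr q + 1" for x
      using young_weighted[OF q, of "excess k x" 1] by simp
  qed measurable
  show "set_integrable lebesgue \<Omega> (\<lambda>x. \<bar>u x\<bar> powr (q - 2) * u x * excess k x)"
  proof (rule set_integrable_dominated)
    show "set_integrable lebesgue \<Omega>
        (\<lambda>x. 2 powr (q - 1) * (excess k x powr q + k powr (q - 1) * excess k x))"
      using 1 2 by (intro set_integrable_mult_right set_integral_add)
    show "\<bar>\<bar>u x\<bar> powr (q - 2) * u x * excess k x\<bar>
        \<le> 2 powr (q - 1) * (excess k x powr q + k powr (q - 1) * excess k x)" for x
      using caccioppoli_integrand_bound[OF q assms, of "u x"] by simp
  qed measurable
qed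

text \<open>The Poincare inequality on the left of the tested equation and
  \<open>caccioppoli_integrand_bound\<close> on its right give the energy hypothesis of
  \<open>level_estimate_absorption\<close>. The exponent obtained is
  \<open>\<epsilon> = \<sigma> / (q - 1)\<close>.\<close>

lemma level_estimate:
  obtains C \<epsilon> m\<^sub>0 where "0 < C" "0 < \<epsilon>" "0 < m\<^sub>0"
    "\<And>k. 0 < k \<Longrightarrow> measure lebesgue (superlevel k) \<le> m\<^sub>0 \<Longrightarrow>
      (LINT x:\<Omega>|lebesgue. excess k x) \<le> C * k * measure lebesgue (superlevel k) powr (1 + \<epsilon>)"
proof -
  obtain c \<rho>\<^sub>0 where c: "0 < c" and \<rho>\<^sub>0: "0 < \<rho>\<^sub>0"
    and dens: "\<And>x \<rho>. x \<in> \<Omega> \<Longrightarrow> 0 < \<rho> \<Longrightarrow> \<rho> \<le> \<rho>\<^sub>0 \<Longrightarrow>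
      c * \<rho> ^ DIM('a) \<le> measure lebesgue (\<Omega> \<inter> ball x \<rho>)"
    using lipschitz_boundary_measure_density[OF open_\<Omega> bounded_\<Omega> lipschitz_\<Omega>] by blast
  define \<sigma> where "\<sigma> = s2 * q / DIM('a)"
  define K where "K = (c / 2) powr (1 + \<sigma>)"
  define \<Lambda> where "\<Lambda> = \<bar>lam\<bar> * 2 powr (q - 1)"
  \<comment> \<open>The first entry keeps the Poincare radius at most \<open>\<rho>\<^sub>0\<close>,
    the second is the absorption condition. Using \<open>\<Lambda> + 1\<close> avoids a division by
    zero when \<open>lam = 0\<close>.\<close>
  define m\<^sub>0 where "m\<^sub>0 = min (c / 2 * \<rho>\<^sub>0 powr DIM('a)) ((K / (2 * (\<Lambda> + 1))) powr (1 / \<sigma>))"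
  define C where "C = 2 * (2 * (2 * \<Lambda> / K + 1)) powr (1 / (q - 1))"
  have \<sigma>: "0 < \<sigma>" using s2 q by (simp add: \<sigma>_def)
  have K: "0 < K" using c by (simp add: K_def)
  have \<Lambda>: "0 \<le> \<Lambda>" by (simp add: \<Lambda>_def)
  have "0 < 2 * \<Lambda> / K + 1" using \<Lambda> K by (intro add_nonneg_pos) auto
  then have C: "0 < C" by (simp add: C_def)
  have m\<^sub>0: "0 < m\<^sub>0" using c \<rho>\<^sub>0 K \<Lambda> by (simp add: m\<^sub>0_def)
  have "(LINT x:\<Omega>|lebesgue. excess k x) \<le> C * k * measure lebesgue (superlevel k) powr (1 + \<sigma> / (q - 1))"
    if k: "0 < k" and small: "measure lebesgue (superlevel k) \<le> m\<^sub>0" for k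
  proof -
    define m where "m = measure lebesgue (superlevel k)"
    let ?W = "LINT x:\<Omega>|lebesgue. excess k x powr q"
    let ?I = "LINT x:\<Omega>|lebesgue. excess k x"
    have k0: "0 \<le> k" using k by simp
    note int = set_integrable_excess[OF k0]
    have W0: "0 \<le> ?W" and I0: "0 \<le> ?I"
      unfolding set_lebesgue_integral_def by (intro integral_nonneg_AE AE_I2; simp)+
    \<comment> \<open>The excess vanishes off the superlevel set, so \<open>\<tau>\<close> is needed
      only there; this yields the factor \<open>m\<close> instead of the measure of
      \<open>\<Omega>\<close>.\<close>
    have young: "?I \<le> \<tau> powr (1 - q) * ?W + \<tau> * m" if \<tau>: "0 < \<tau>" for \<tau>
    proof -
      have ind: "set_integrable lebesgue \<Omega> (indicat_real (superlevel k))"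
        using superlevel_lmeasurable[of k]
        by (intro set_integrable_dominated[OF set_integrable_const_\<Omega>[of 1]])
          (auto split: split_indicator)
      have "?I \<le> (LINT x:\<Omega>|lebesgue. \<tau> powr (1 - q) * excess k x powr q + \<tau> * indicator (superlevel k) x)"
      proof (rule set_integral_mono[OF int(2)])
        show "set_integrable lebesgue \<Omega>
            (\<lambda>x. \<tau> powr (1 - q) * excess k x powr q + \<tau> * indicator (superlevel k) x)"
          using int(1) ind by (intro set_integral_add set_integrable_mult_right)
        show "excess k x \<le> \<tau> powr (1 - q) * excess k x powr q + \<tau> * indicator (superlevel k) x"
          if "x \<in> \<Omega>" for x
          using young_weighted[OF q, of "excess k x" \<tau>] \<tau> that by (auto split: split_indicator)
      qed
      also have "\<dots> = \<tau> powr (1 - q) * ?W + \<tau> * (LINT x:\<Omega>|lebesgue. indicator (superlevel k) x)"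
        using int(1) ind by (subst set_integral_add(2)) auto
      also have "(LINT x:\<Omega>|lebesgue. indicat_real (superlevel k) x) = (\<integral>x. indicator (superlevel k) x \<partial>lebesgue)"
        unfolding set_lebesgue_integral_def
        by (intro Bochner_Integration.integral_cong) (auto split: split_indicator)
      also have "\<dots> = m" by (simp add: m_def)
      finally show ?thesis .
    qed
    show ?thesis
    \<comment> \<open>The Poincare inequality requires \<open>0 < m\<close>; over a null superlevel
      set the integral of the excess is zero.\<close>
    proof (cases "m = 0")
      case True
      have "AE x in lebesgue. x \<notin> superlevel k"
        using True by (intro AE_not_superlevel) (simp add: m_def)
      then have "AE x in lebesgue. indicator \<Omega> x *\<^sub>R excess k x = 0"
        by eventually_elim (auto split: split_indicator)
      then have "?I = 0"
        unfolding set_lebesgue_integral_def by (rule integral_eq_zero_AE)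
      then show ?thesis using True by (simp add: m_def)
    next
      case False
      then have m: "0 < m" by (simp add: m_def zero_less_measure_iff)
      have m_sup: "m = measure lebesgue {x \<in> \<Omega>. 0 < excess k x}" by (simp add: m_def less_max_iff_disj)
      have "2 * m / c \<le> \<rho>\<^sub>0 powr DIM('a)"
        using small c by (simp add: m_def m\<^sub>0_def field_simps)
      then have "(2 * m / c) powr (1 / DIM('a)) \<le> (\<rho>\<^sub>0 powr DIM('a)) powr (1 / DIM('a))"
        using m c by (intro powr_mono2) auto
      also have "\<dots> = \<rho>\<^sub>0" using \<rho>\<^sub>0 by (simp add: powr_powr)
      finally have rad: "(2 * m / c) powr (1 / real DIM('a)) \<le> \<rho>\<^sub>0" .
      have "excess k \<in> borel_measurable lebesgue" by measurable
      from fractional_poincare_small_support[OF this _ \<Omega>_lmeasurable dens c s2 _ m_sup m rad] q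
      have "ennreal (K * m powr (- \<sigma>)) * (\<integral>\<^sup>+x\<in>\<Omega>. ennreal (\<bar>excess k x\<bar> powr q) \<partial>lebesgue)
          \<le> gagliardo_energy \<Omega> s2 q (excess k)"
        by (simp add: K_def \<sigma>_def)
      also have "\<dots> \<le> ennreal (lam * (LINT x:\<Omega>|lebesgue. \<bar>u x\<bar> powr (q - 2) * u x * excess k x))"
        by (rule excess_forms(4)[OF k0])
      also have "\<dots> \<le> ennreal (\<Lambda> * (?W + k powr (q - 1) * ?I))"
      proof (rule ennreal_leI)
        let ?X = "LINT x:\<Omega>|lebesgue. \<bar>u x\<bar> powr (q - 2) * u x * excess k x"
        have X0: "0 \<le> ?X"
          unfolding set_lebesgue_integral_def
          using caccioppoli_integrand_bound(1)[OF q k0] by (intro integral_nonneg_AE AE_I2) simp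
        have "?X \<le> (LINT x:\<Omega>|lebesgue. 2 powr (q - 1) * (excess k x powr q + k powr (q - 1) * excess k x))"
          using int caccioppoli_integrand_bound(2)[OF q k0]
          by (intro set_integral_mono set_integrable_mult_right set_integral_add)
        also have "\<dots> = 2 powr (q - 1) * (?W + k powr (q - 1) * ?I)"
          using int by (simp add: set_integral_add(2))
        finally have "\<bar>lam\<bar> * ?X \<le> \<bar>lam\<bar> * (2 powr (q - 1) * (?W + k powr (q - 1) * ?I))"
          by (intro mult_left_mono) auto
        \<comment> \<open>The sign of \<open>lam\<close> is arbitrary, but \<open>?X\<close> is
          nonnegative.\<close>
        moreover have "lam * ?X \<le> \<bar>lam\<bar> * ?X" using X0 by (intro mult_right_mono) auto
        ultimately show "lam * ?X \<le> \<Lambda> * (?W + k powr (q - 1) * ?I)"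
          by (simp add: \<Lambda>_def mult.assoc)
      qed
      also have "(\<integral>\<^sup>+x\<in>\<Omega>. ennreal (\<bar>excess k x\<bar> powr q) \<partial>lebesgue) = ennreal ?W"
      proof -
        have "(\<integral>\<^sup>+x\<in>\<Omega>. ennreal (\<bar>excess k x\<bar> powr q) \<partial>lebesgue)
            = (\<integral>\<^sup>+x. ennreal (indicator \<Omega> x *\<^sub>R excess k x powr q) \<partial>lebesgue)"
          by (intro nn_integral_cong) (auto split: split_indicator)
        also have "\<dots> = ennreal ?W"
          using int(1) unfolding set_integrable_def set_lebesgue_integral_def
          by (intro nn_integral_eq_integral) auto
        finally show ?thesis .
      qed
      finally have "K * m powr (- \<sigma>) * ?W \<le> \<Lambda> * (?W + k powr (q - 1) * ?I)"
        using K W0 I0 \<Lambda> by (simp flip: ennreal_mult)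
      moreover have "\<Lambda> * m powr \<sigma> \<le> K / 2"
      proof -
        have "m powr \<sigma> \<le> ((K / (2 * (\<Lambda> + 1))) powr (1 / \<sigma>)) powr \<sigma>"
          using small m \<sigma> by (intro powr_mono2) (auto simp: m_def m\<^sub>0_def)
        also have "\<dots> = K / (2 * (\<Lambda> + 1))" using K \<Lambda> \<sigma> by (simp add: powr_powr)
        finally have "(\<Lambda> + 1) * m powr \<sigma> \<le> K / 2" using \<Lambda> by (simp add: field_simps)
        moreover have "\<Lambda> * m powr \<sigma> \<le> (\<Lambda> + 1) * m powr \<sigma>" by (intro mult_right_mono) auto
        ultimately show ?thesis by linarith
      qed
      ultimately show ?thesis
        using level_estimate_absorption[OF q k m W0 I0 K \<Lambda> _ _ young]
        by (simp add: C_def m_def)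
    qed
  qed
  moreover have "0 < \<sigma> / (q - 1)" using \<sigma> q by simp
  ultimately show thesis using that C m\<^sub>0 by blast
qed

text \<open>The iteration is applied to the measure of the superlevel set as a function of the
  level; a level where it is zero is an essential upper bound.\<close>

lemma bounded_above_\<Omega>: "\<exists>K. AE x in lebesgue. x \<in> \<Omega> \<longrightarrow> u x \<le> K"
proof -
  obtain C \<epsilon> m\<^sub>0 where pos: "0 < C" "0 < \<epsilon>" "0 < m\<^sub>0"
    and est: "\<And>k. 0 < k \<Longrightarrow> measure lebesgue (superlevel k) \<le> m\<^sub>0 \<Longrightarrow>
      (LINT x:\<Omega>|lebesgue. excess k x) \<le> C * k * measure lebesgue (superlevel k) powr (1 + \<epsilon>)"
    using level_estimate by blast
  let ?f = "\<lambda>k. measure lebesgue (superlevel k)"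
  have sets: "superlevel k \<in> sets lebesgue" for k using superlevel_lmeasurable[of k] by auto
  have anti: "antimono ?f"
    by (intro antimonoI measure_mono_fmeasurable sets superlevel_lmeasurable) auto
  \<comment> \<open>Continuity from above for sets of finite measure; the intersection is empty
    because \<open>u\<close> is real-valued.\<close>
  have lim: "(\<lambda>n::nat. ?f (real n)) \<longlonglongrightarrow> 0"
  proof -
    have "(\<lambda>n::nat. ?f (real n)) \<longlonglongrightarrow> measure lebesgue (\<Inter>n::nat. superlevel (real n))"
      using superlevel_lmeasurable sets
      by (intro Lim_measure_decseq) (auto simp: decseq_def fmeasurable_def less_top)
    moreover have "(\<Inter>n::nat. superlevel (real n)) = {}"
      by auto (metis not_less reals_Archimedean2 less_le)
    ultimately show ?thesis by simp
  qed
  have step: "(h - k) * ?f h \<le> C * k * ?f k powr (1 + \<epsilon>)"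
    if "0 < k" "k < h" "?f k \<le> m\<^sub>0" for k h
  proof -
    \<comment> \<open>Chebyshev: on \<open>superlevel h\<close> the excess over \<open>k\<close> is
      at least \<open>h - k\<close>.\<close>
    have "(h - k) * ?f h = (\<integral>x. (h - k) * indicator (superlevel h) x \<partial>lebesgue)" by simp
    also have "\<dots> \<le> (LINT x:\<Omega>|lebesgue. excess k x)"
      unfolding set_lebesgue_integral_def
    proof (rule integral_mono)
      show "integrable lebesgue (\<lambda>x. (h - k) * indicator (superlevel h) x)"
        using superlevel_lmeasurable[of h] by (auto simp: fmeasurable_def)
      show "integrable lebesgue (\<lambda>x. indicat_real \<Omega> x *\<^sub>R excess k x)"
        using set_integrable_excess(2)[of k] that by (simp add: set_integrable_def)
      show "(h - k) * indicator (superlevel h) x \<le> indicat_real \<Omega> x *\<^sub>R excess k x" for x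
        using that by (auto split: split_indicator)
    qed
    also have "\<dots> \<le> C * k * ?f k powr (1 + \<epsilon>)" using est that by blast
    finally show ?thesis .
  qed
  obtain K where "?f K = 0"
    using de_giorgi_iteration[of ?f, OF measure_nonneg anti lim pos step] by blast
  then have "AE x in lebesgue. x \<notin> superlevel K"
    by (rule AE_not_superlevel)
  then have "AE x in lebesgue. x \<in> \<Omega> \<longrightarrow> u x \<le> K" by eventually_elim auto
  then show ?thesis by blast
qed

end

subsection \<open>The exterior of the domain\<close>

context pq_eigenproblem
begin

text \<open>For \<open>x \<in> \<Omega>\<close> and \<open>u x \<le> M < u y\<close> the integrand of the pairing of \<open>u\<close> with
  \<open>(u - M)\<^sup>+\<close> is strictly positive at \<open>(x, y)\<close>, whereas the pairing vanishes.\<close>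
lemma AE_le_of_AE_le_\<Omega>:
  assumes "\<Omega> \<noteq> {}" "0 \<le> M" and ae: "AE x in lebesgue. x \<in> \<Omega> \<longrightarrow> u x \<le> M"
  shows "AE y in lebesgue. u y \<le> M"
proof -
  have "AE x in lebesgue. indicator \<Omega> x *\<^sub>R (\<bar>u x\<bar> powr (q - 2) * u x * excess M x) = 0"
    using ae by eventually_elim (auto split: split_indicator)
  then have "(LINT x:\<Omega>|lebesgue. \<bar>u x\<bar> powr (q - 2) * u x * excess M x) = 0"
    unfolding set_lebesgue_integral_def by (rule integral_eq_zero_AE)
  \<comment> \<open>Two nonnegative forms with sum zero both vanish.\<close>
  then have form0: "gagliardo_form \<Omega> s2 q u (excess M) = 0"
    using excess_forms(1-3)[OF assms(2)] by simp
  define F where "F = (\<lambda>z. (case z of (x, y) \<Rightarrow>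
      ennreal (\<bar>u x - u y\<bar> powr (q - 2) * (u x - u y) * (excess M x - excess M y)
         / norm (x - y) powr (real DIM('a) + q * s2))) * indicator (Q_set \<Omega>) z)"
  have F_meas: "F \<in> borel_measurable (lebesgue \<Otimes>\<^sub>M lebesgue)"
  proof -
    have [measurable]: "Q_set \<Omega> \<in> sets (lebesgue \<Otimes>\<^sub>M lebesgue)" by (rule sets_Q_set[OF \<Omega>_sets])
    show ?thesis unfolding F_def by measurable
  qed
  have exc: "excess M \<in> borel_measurable lebesgue" by measurable
  have "u \<in> X_space \<Omega> s2 q" using weak by (simp add: weak_solution_def)
  from gagliardo_form_truncation(2)[OF truncation_of_pos_part[OF assms(2)] exc \<Omega>_sets this q]
  have "integral\<^sup>N (lebesgue \<Otimes>\<^sub>M lebesgue) F = 0"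
    by (simp add: form0 F_def)
  \<comment> \<open>A nonnegative integrand of integral zero vanishes almost everywhere, hence on
    almost every section.\<close>
  then have "AE z in lebesgue \<Otimes>\<^sub>M lebesgue. F z = 0"
    using nn_integral_0_iff_AE[OF F_meas] by simp
  moreover have "pair_sigma_finite (lebesgue :: 'a measure) (lebesgue :: 'a measure)"
    by (intro pair_sigma_finite.intro sigma_finite_lebesgue)
  ultimately have "AE x in lebesgue. AE y in lebesgue. F (x, y) = 0"
    by (intro pair_sigma_finite.AE_pair)
  \<comment> \<open>A nonempty open set is not null, so one good point \<open>x\<close> of
    \<open>\<Omega>\<close> exists; its section controls almost every \<open>y\<close> in the whole
    space.\<close>
  moreover have "\<not> (AE x in lebesgue. x \<notin> \<Omega>)"
  proof
    assume "AE x in lebesgue. x \<notin> \<Omega>"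
    then have "\<Omega> \<in> null_sets lebesgue" by (simp add: AE_iff_null_sets)
    then show False
      using open_not_negligible[OF open_\<Omega> assms(1)] by (simp add: negligible_iff_null_sets)
  qed
  ultimately obtain x where x: "x \<in> \<Omega>" "u x \<le> M" "AE y in lebesgue. F (x, y) = 0"
  proof -
    assume *: "\<not> (AE x in lebesgue. x \<notin> \<Omega>)" "AE x in lebesgue. AE y in lebesgue. F (x, y) = 0"
    have "\<exists>x. x \<in> \<Omega> \<and> u x \<le> M \<and> (AE y in lebesgue. F (x, y) = 0)"
    proof (rule ccontr)
      assume none: "\<not> ?thesis"
      have "AE x in lebesgue. x \<notin> \<Omega>"
        using *(2) ae by eventually_elim (use none in blast)
      with *(1) show False by contradiction
    qed
    then show thesis using that by blast
  qed
  from x(3) show ?thesis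
  proof eventually_elim
    case (elim y)
    show "u y \<le> M"
    proof (rule ccontr)
      assume "\<not> u y \<le> M"
      then have y: "M < u y" "x \<noteq> y" using x(2) by auto
      have "0 < (u y - u x) * (u y - M)" using y x(2) by (intro mult_pos_pos) auto
      moreover have "excess M x - excess M y = - (u y - M)" using y x(2) by simp
      then have "(u x - u y) * (excess M x - excess M y) = (u y - u x) * (u y - M)"
        by (simp only:) (simp add: algebra_simps)
      ultimately have "0 < (u x - u y) * (excess M x - excess M y)" by simp
      moreover have "0 < \<bar>u x - u y\<bar> powr (q - 2)" using y x(2) by simp
      ultimately have "0 < \<bar>u x - u y\<bar> powr (q - 2) * (u x - u y) * (excess M x - excess M y)"
        by (simp only: mult.assoc mult_pos_pos)
      then have "0 < \<bar>u x - u y\<bar> powr (q - 2) * (u x - u y) * (excess M x - excess M y)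
          / norm (x - y) powr (real DIM('a) + q * s2)"
        using y(2) by (intro divide_pos_pos) auto
      moreover have "(x, y) \<in> Q_set \<Omega>" using x(1) by (simp add: Q_set_def)
      ultimately have "0 < F (x, y)"
        unfolding F_def by (simp only: prod.case indicator_simps mult_1_right ennreal_less_zero_iff)
      with elim show False by simp
    qed
  qed
qed

end

section \<open>Symmetry under change of sign, and the two-sided bound\<close>

lemma X_space_uminus:
  assumes "u \<in> X_space \<Omega> s r"
  shows "(\<lambda>x. - u x) \<in> X_space \<Omega> s r"
proof -
  have "gagliardo_energy \<Omega> s r (\<lambda>x. - u x) = gagliardo_energy \<Omega> s r u"
    unfolding gagliardo_energy_def minus_diff_minus abs_minus_cancel ..
  then show ?thesis using assms by (simp add: X_space_iff)
qed

lemma gagliardo_form_uminus: "gagliardo_form \<Omega> s r (\<lambda>x. - u x) v = - gagliardo_form \<Omega> s r u v"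
  unfolding gagliardo_form_def set_lebesgue_integral_def minus_diff_minus abs_minus_cancel
    mult_minus_left mult_minus_right minus_divide_left[symmetric] case_prod_beta scaleR_minus_right
  by (rule Bochner_Integration.integral_minus)

text \<open>Both forms and the right-hand side are odd in the solution.\<close>

lemma weak_solution_uminus:
  assumes "weak_solution \<Omega> s1 p s2 q lam u"
  shows "weak_solution \<Omega> s1 p s2 q lam (\<lambda>x. - u x)"
proof -
  have int: "(LINT x:\<Omega>|lebesgue. \<bar>- u x\<bar> powr (q - 2) * - u x * v x)
      = - (LINT x:\<Omega>|lebesgue. \<bar>u x\<bar> powr (q - 2) * u x * v x)" for v
    unfolding set_lebesgue_integral_def abs_minus_cancel mult_minus_left mult_minus_right
      scaleR_minus_right by (rule Bochner_Integration.integral_minus)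
  have form: "gagliardo_form \<Omega> s1 p u v + gagliardo_form \<Omega> s2 q u v
      = lam * (LINT x:\<Omega>|lebesgue. \<bar>u x\<bar> powr (q - 2) * u x * v x)"
    if "v \<in> X_space \<Omega> s1 p \<inter> X_space \<Omega> s2 q" for v
    using assms that unfolding weak_solution_def by blast
  have "gagliardo_form \<Omega> s1 p (\<lambda>x. - u x) v + gagliardo_form \<Omega> s2 q (\<lambda>x. - u x) v
      = lam * (LINT x:\<Omega>|lebesgue. \<bar>- u x\<bar> powr (q - 2) * - u x * v x)"
    if "v \<in> X_space \<Omega> s1 p \<inter> X_space \<Omega> s2 q" for v
    unfolding gagliardo_form_uminus int using form[OF that] by (simp only: mult_minus_right)
  moreover have "(\<lambda>x. - u x) \<in> X_space \<Omega> s1 p \<inter> X_space \<Omega> s2 q"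
    using assms X_space_uminus[of u] unfolding weak_solution_def by simp
  ultimately show ?thesis unfolding weak_solution_def by simp
qed

theorem theorem1p3:
  fixes \<Omega> :: "(real ^ 'n) set"
    and s1 s2 p q lam :: real
    and u :: "real ^ 'n \<Rightarrow> real"
  assumes "CARD('n) \<ge> 2"
    and "open \<Omega>" and "bounded \<Omega>" and "\<Omega> \<noteq> {}" and "lipschitz_boundary \<Omega>"
    and "s1 \<in> {0<..<1}" and "s2 \<in> {0<..<1}"
    and "p > 1" and "q > 1"
    and "weak_solution \<Omega> s1 p s2 q lam u"
  shows "u \<in> Linf_space UNIV \<and> Linf_norm UNIV u \<le> 2 * Linf_norm \<Omega> u"
proof -
  have s2: "0 < s2" using assms(7) by simp
  interpret pos: pq_eigenproblem \<Omega> s1 p s2 q lam u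
    by (rule pq_eigenproblem.intro[OF assms(2,3,5) s2 assms(8-10)])
  interpret neg: pq_eigenproblem \<Omega> s1 p s2 q lam "\<lambda>x. - u x"
    by (rule pq_eigenproblem.intro[OF assms(2,3,5) s2 assms(8,9) weak_solution_uminus[OF assms(10)]])
  have meas: "(\<lambda>x. ennreal \<bar>u x\<bar>) \<in> borel_measurable lebesgue" by measurable
  then have meas_\<Omega>: "(\<lambda>x. ennreal \<bar>u x\<bar>) \<in> borel_measurable (lebesgue_on \<Omega>)"
    by (rule measurable_restrict_space1)
  have AE_on: "(AE x in lebesgue_on \<Omega>. P x) \<longleftrightarrow> (AE x in lebesgue. x \<in> \<Omega> \<longrightarrow> P x)" for P
    by (subst AE_restrict_space_iff) auto
  obtain K L where "AE x in lebesgue. x \<in> \<Omega> \<longrightarrow> u x \<le> K" "AE x in lebesgue. x \<in> \<Omega> \<longrightarrow> - u x \<le> L"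
    using pos.bounded_above_\<Omega> neg.bounded_above_\<Omega> by blast
  then have "AE x in lebesgue. x \<in> \<Omega> \<longrightarrow> ennreal \<bar>u x\<bar> \<le> ennreal (max K L)"
    by eventually_elim (auto intro!: ennreal_leI)
  then have "Linf_norm \<Omega> u \<le> ennreal (max K L)"
    unfolding Linf_norm_def using meas_\<Omega> by (intro esssup_I) (simp_all add: AE_on)
  also have "\<dots> < \<infinity>" by simp
  finally have fin: "Linf_norm \<Omega> u < \<infinity>" .
  \<comment> \<open>\<open>M\<close> is the exact essential bound on \<open>\<Omega>\<close>, so the
    exterior estimate at this level loses nothing.\<close>
  define M where "M = enn2real (Linf_norm \<Omega> u)"
  have M: "Linf_norm \<Omega> u = ennreal M" "0 \<le> M" using fin by (auto simp: M_def)
  have "AE x in lebesgue_on \<Omega>. ennreal \<bar>u x\<bar> \<le> ennreal M"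
    unfolding M(1)[symmetric] unfolding Linf_norm_def by (rule esssup_AE)
  then have "AE x in lebesgue. x \<in> \<Omega> \<longrightarrow> ennreal \<bar>u x\<bar> \<le> ennreal M"
    by (simp only: AE_on)
  then have M_bd: "AE x in lebesgue. x \<in> \<Omega> \<longrightarrow> \<bar>u x\<bar> \<le> M"
    by eventually_elim (use M(2) in simp)
  have "AE x in lebesgue. u x \<le> M"
    by (rule pos.AE_le_of_AE_le_\<Omega>[OF assms(4) M(2)])
      (use M_bd in eventually_elim, auto)
  moreover have "AE x in lebesgue. - u x \<le> M"
    by (rule neg.AE_le_of_AE_le_\<Omega>[OF assms(4) M(2)])
      (use M_bd in eventually_elim, auto)
  ultimately have "AE x in lebesgue. ennreal \<bar>u x\<bar> \<le> ennreal M"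
    by eventually_elim (auto intro!: ennreal_leI)
  then have "Linf_norm UNIV u \<le> ennreal M"
    unfolding Linf_norm_def lebesgue_on_UNIV_eq by (rule esssup_I[OF meas])
  then have le: "Linf_norm UNIV u \<le> Linf_norm \<Omega> u" by (simp add: M(1))
  then have "u \<in> Linf_space UNIV"
    using fin pos.u_measurable by (simp add: Linf_space_def lebesgue_on_UNIV_eq)
  \<comment> \<open>The argument gives the constant 1, which is then weakened to 2.\<close>
  moreover have "Linf_norm \<Omega> u \<le> 2 * Linf_norm \<Omega> u"
    by (simp add: M(1) M(2) flip: ennreal_numeral ennreal_mult)
  ultimately show ?thesis using le by auto
qed

end
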